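(* Let $d$ be a positive integer. If $G$ is a bipartite, $d$-regular graph on $4n$ vertices (for some positive integer $n$), then $G$ is balanceable.
   Context: All graphs are simple and finite. A 2-coloring of the edges of $K_N$ is a function $\alpha:E(K_N)\to\{R,B\}$. It contains a balanced copy of a graph $G$ if $K_N$ has a (not necessarily induced) subgraph isomorphic to $G$ whose edge set is partitioned into $E_1,E_2$ with $\alpha(e)=R$ for $e\in E_1$, $\alpha(e)=B$ for $e\in E_2$, and $\big||E_1|-|E_2|\big|\le 1$. A graph $G$ is balanceable if there is an $N_0$ such that for every $N\ge N_0$ there exists an integer $m$ with $0\le m<\lfloor \frac12\binom N2\rfloor$ such that every 2-coloring $\alpha$ of $E(K_N)$ with $|\alpha^{-1}(R)|>m$ and $|\alpha^{-1}(B)|>m$ contains a balanced copy of $G$. *)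

theory Defs
  imports Main
begin

record 'a ugraph =
  verts :: "'a set"
  edges :: "'a set set"

definition simple_graph :: "'a ugraph \<Rightarrow> bool" where
  "simple_graph G \<longleftrightarrow> finite (verts G) \<and> (\<forall>e\<in>edges G. e \<subseteq> verts G \<and> card e = 2)"

definition subgraph :: "'a ugraph \<Rightarrow> 'a ugraph \<Rightarrow> bool" where
  "subgraph H G \<longleftrightarrow> simple_graph H \<and> verts H \<subseteq> verts G \<and> edges H \<subseteq> edges G"

definition isomorphic :: "'a ugraph \<Rightarrow> 'b ugraph \<Rightarrow> bool" where
  "isomorphic G H \<longleftrightarrow>
     (\<exists>f. bij_betw f (verts G) (verts H) \<and>
          (\<forall>u\<in>verts G. \<forall>v\<in>verts G. {u, v} \<in> edges G \<longleftrightarrow> {f u, f v} \<in> edges H))"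

definition degree :: "'a ugraph \<Rightarrow> 'a \<Rightarrow> nat" where
  "degree G v = card {e \<in> edges G. v \<in> e}"

definition regular :: "nat \<Rightarrow> 'a ugraph \<Rightarrow> bool" where
  "regular d G \<longleftrightarrow> (\<forall>v\<in>verts G. degree G v = d)"

definition bipartite :: "'a ugraph \<Rightarrow> bool" where
  "bipartite G \<longleftrightarrow>
     (\<exists>X Y. X \<union> Y = verts G \<and> X \<inter> Y = {} \<and> (\<forall>e\<in>edges G. \<exists>x\<in>X. \<exists>y\<in>Y. e = {x, y}))"

definition complete_graph :: "nat \<Rightarrow> nat ugraph" where
  "complete_graph N = \<lparr>verts = {..<N}, edges = {e. e \<subseteq> {..<N} \<and> card e = 2}\<rparr>"

datatype color = Red | Blue

text \<open>A colouring of the edges of the complete graph is a total function on sets of naturals;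
  every notion below inspects it only on edges, so its values elsewhere are irrelevant.\<close>

definition color_class :: "nat \<Rightarrow> (nat set \<Rightarrow> color) \<Rightarrow> color \<Rightarrow> nat set set" where
  "color_class N \<alpha> c = {e \<in> edges (complete_graph N). \<alpha> e = c}"

definition contains_balanced_copy :: "nat \<Rightarrow> (nat set \<Rightarrow> color) \<Rightarrow> 'a ugraph \<Rightarrow> bool" where
  "contains_balanced_copy N \<alpha> G \<longleftrightarrow>
     (\<exists>H E1 E2. subgraph H (complete_graph N) \<and> isomorphic G H \<and>
        edges H = E1 \<union> E2 \<and> E1 \<inter> E2 = {} \<and>
        (\<forall>e\<in>E1. \<alpha> e = Red) \<and> (\<forall>e\<in>E2. \<alpha> e = Blue) \<and>
        \<bar>int (card E1) - int (card E2)\<bar> \<le> 1)"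

definition balanceable :: "'a ugraph \<Rightarrow> bool" where
  "balanceable G \<longleftrightarrow>
     (\<exists>N0. \<forall>N\<ge>N0. \<exists>m::nat. m < (N choose 2) div 2 \<and>
        (\<forall>\<alpha>. card (color_class N \<alpha> Red) > m \<and> card (color_class N \<alpha> Blue) > m \<longrightarrow>
             contains_balanced_copy N \<alpha> G))"

end

(* Removing half of one side of the bipartition splits the 2nd edges of G evenly: if S consists of n
   of the 2n vertices of the part X, then nd edges meet S and nd edges do not. So a balanced copy
   appears as soon as there are disjoint sets A, B, C of sizes n, 2n, n with all A-B edges red and
   all B-C edges blue. With m maximal, both colour classes contain about half of the edges. Then
   there are of order N^3 red-blue paths of length two, so linearly many vertices v have linear
   degree in both colours. Double counting triples (v, A, C), where A lies in the red and C in the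
   blue neighbourhood of v, gives a pair (A, C) shared by linearly many vertices v, from which B
   is taken. *)
theory Submission
  imports Defs Complex_Main
begin

section \<open>Two-step paths and the extraction of two bicliques\<close>

text \<open>Each element of P x Q can be recovered from a path (a P-step followed by a Q-step)
  together with one more vertex, by one of three maps; this gives the factor
  \<open>3 * card V\<close>. Consequently, if P and Q both have quadratic size, there are cubically
  many such paths.\<close>

lemma card_mult_le_two_step_paths:
  fixes P Q :: "('a \<times> 'a) set"
  assumes V: "finite V" and P: "P \<subseteq> V \<times> V" and Q: "Q \<subseteq> V \<times> V"
    and total: "\<And>a b. a \<in> V \<Longrightarrow> b \<in> V \<Longrightarrow> a \<noteq> b \<Longrightarrow> (a, b) \<in> P \<union> Q"
  shows "card P * card Q \<le> 3 * card V * (\<Sum>v\<in>V. card (P\<inverse> `` {v}) * card (Q `` {v}))"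
proof -
  \<comment> \<open>The middle vertex comes first: (v, a, c) stands for the path a, v, c with (a, v)
    in P and (v, c) in Q.\<close>
  define T where "T = (SIGMA v:V. P\<inverse> `` {v} \<times> Q `` {v})"
  have fin: "finite (P\<inverse> `` {v})" "finite (Q `` {v})" for v
    using P Q V by (auto intro!: finite_subset[OF _ V])
  have finT: "finite T"
    unfolding T_def using V fin by blast
  have cardT: "card T = (\<Sum>v\<in>V. card (P\<inverse> `` {v}) * card (Q `` {v}))"
    unfolding T_def using V fin by (simp add: card_cartesian_product)
  define f1 :: "('a \<times> 'a \<times> 'a) \<times> 'a \<Rightarrow> ('a \<times> 'a) \<times> ('a \<times> 'a)"
    where "f1 = (\<lambda>((c, b, d), a). ((a, b), (c, d)))"
  define f2 :: "('a \<times> 'a \<times> 'a) \<times> 'a \<Rightarrow> ('a \<times> 'a) \<times> ('a \<times> 'a)"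
    where "f2 = (\<lambda>((b, a, c), d). ((a, b), (c, d)))"
  \<comment> \<open>In the degenerate case the path determines both pairs; the ignored vertex only
    gives the three maps a common domain.\<close>
  define f3 :: "('a \<times> 'a \<times> 'a) \<times> 'a \<Rightarrow> ('a \<times> 'a) \<times> ('a \<times> 'a)"
    where "f3 = (\<lambda>((b, a, d), _). ((a, b), (b, d)))"
  (* Given (a, b) in P and (c, d) in Q, the pair (b, c) either degenerates, extends (c, d)
     backwards or extends (a, b) forwards to a two-step path; one endpoint stays free. *)
  have "P \<times> Q \<subseteq> f1 ` (T \<times> V) \<union> f2 ` (T \<times> V) \<union> f3 ` (T \<times> V)"
  proof clarify
    fix a b c d
    assume ab: "(a, b) \<in> P" and cd: "(c, d) \<in> Q"
      and n2: "((a, b), (c, d)) \<notin> f2 ` (T \<times> V)" and n3: "((a, b), (c, d)) \<notin> f3 ` (T \<times> V)"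
    have V': "a \<in> V" "b \<in> V" "c \<in> V" "d \<in> V"
      using ab cd P Q by auto
    have "b \<noteq> c"
    proof
      assume "b = c"
      then have "((b, a, d), a) \<in> T \<times> V" using ab cd V' by (auto simp: T_def)
      then have "f3 ((b, a, d), a) \<in> f3 ` (T \<times> V)" by blast
      with n3 \<open>b = c\<close> show False by (simp add: f3_def)
    qed
    moreover have "(b, c) \<notin> Q"
    proof
      assume "(b, c) \<in> Q"
      then have "((b, a, c), d) \<in> T \<times> V" using ab V' by (auto simp: T_def)
      then have "f2 ((b, a, c), d) \<in> f2 ` (T \<times> V)" by blast
      with n2 show False by (simp add: f2_def)
    qed
    ultimately have "(b, c) \<in> P" using total V' by blast
    then have "((c, b, d), a) \<in> T \<times> V" using cd V' by (auto simp: T_def)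
    then have "f1 ((c, b, d), a) \<in> f1 ` (T \<times> V)" by blast
    then show "((a, b), (c, d)) \<in> f1 ` (T \<times> V)" by (simp add: f1_def)
  qed
  then have "card (P \<times> Q) \<le> card (f1 ` (T \<times> V) \<union> f2 ` (T \<times> V) \<union> f3 ` (T \<times> V))"
    using finT V by (intro card_mono) auto
  also have "\<dots> \<le> card (f1 ` (T \<times> V)) + card (f2 ` (T \<times> V)) + card (f3 ` (T \<times> V))"
    by (meson add_le_mono1 card_Un_le le_trans)
  also have "\<dots> \<le> card (T \<times> V) + card (T \<times> V) + card (T \<times> V)"
    using finT V by (intro add_mono card_image_le) auto
  finally show ?thesis
    by (simp add: card_cartesian_product cardT mult.commute mult.left_commute)
qed

text \<open>Averaging: each v in M contributes at least \<open>(k choose n)\<^sup>2\<close> pairs of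
  n-subsets, all taken from a pool of \<open>(card V choose n)\<^sup>2\<close> pairs, so a pair
  chosen most often reaches at least the average. Multiplying out the denominator keeps the estimate
  in the natural numbers.\<close>

lemma exists_common_subset_pair:
  fixes X Y :: "'i \<Rightarrow> 'a set"
  assumes V: "finite V" and M: "finite M" "M \<noteq> {}" and nk: "n \<le> k"
    and XY: "\<And>v. v \<in> M \<Longrightarrow> X v \<subseteq> V \<and> Y v \<subseteq> V \<and> k \<le> card (X v) \<and> k \<le> card (Y v)"
  obtains A C where "card A = n" "card C = n"
    "card M * (k choose n)\<^sup>2 \<le> (card V choose n)\<^sup>2 * card {v \<in> M. A \<subseteq> X v \<and> C \<subseteq> Y v}"
proof -
  define K where "K = (\<lambda>Z::'a set. {A. A \<subseteq> Z \<and> card A = n})"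
  define D where "D = (\<lambda>p. {v \<in> M. fst p \<subseteq> X v \<and> snd p \<subseteq> Y v})"
  have cardK: "card (K Z) = card Z choose n" if "finite Z" for Z
    unfolding K_def using n_subsets[OF that] .
  have finK: "finite (K Z)" if "finite Z" for Z
    unfolding K_def using that by simp
  have fXY: "finite (X v)" "finite (Y v)" if "v \<in> M" for v
    using XY[OF that] V finite_subset by auto
  have "card M * (k choose n)\<^sup>2 = (\<Sum>v\<in>M. (k choose n) * (k choose n))"
    by (simp add: power2_eq_square)
  also have "\<dots> \<le> (\<Sum>v\<in>M. card (K (X v) \<times> K (Y v)))"
    using XY fXY by (intro sum_mono) (auto simp: card_cartesian_product cardK intro!: mult_mono binomial_right_mono)
  also have "\<dots> = (\<Sum>v\<in>M. card {p \<in> K V \<times> K V. v \<in> D p})"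
  proof (intro sum.cong refl arg_cong[where f = card])
    fix v assume "v \<in> M"
    then have "X v \<subseteq> V" "Y v \<subseteq> V" using XY by auto
    then show "K (X v) \<times> K (Y v) = {p \<in> K V \<times> K V. v \<in> D p}"
      using \<open>v \<in> M\<close> by (auto simp: K_def D_def)
  qed
  also have "\<dots> = (\<Sum>p\<in>K V \<times> K V. card {v \<in> M. v \<in> D p})"
    using M V finK by (intro sum_multicount_gen[symmetric]) auto
  also have "\<dots> = (\<Sum>p\<in>K V \<times> K V. card (D p))"
    by (intro sum.cong refl arg_cong[where f = card]) (auto simp: D_def)
  finally have le: "card M * (k choose n)\<^sup>2 \<le> (\<Sum>p\<in>K V \<times> K V. card (D p))" .
  \<comment> \<open>A member of M forces n \<le> \<open>card V\<close>, so n-subsets of V exist and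
    the maximum below is attained.\<close>
  obtain v where "v \<in> M" using M by blast
  then have "n \<le> card V"
    using XY[OF \<open>v \<in> M\<close>] nk card_mono[OF V, of "X v"] by linarith
  then have ne: "K V \<noteq> {}"
    using cardK[OF V] by (metis card.empty binomial_eq_0_iff not_less)
  have finKK: "finite (K V \<times> K V)" using finK V by blast
  define m where "m = Max ((\<lambda>p. card (D p)) ` (K V \<times> K V))"
  have "m \<in> (\<lambda>p. card (D p)) ` (K V \<times> K V)"
    unfolding m_def using finKK ne by (intro Max_in) auto
  then obtain A C where AC: "A \<in> K V" "C \<in> K V" "m = card (D (A, C))" by auto
  have "(\<Sum>p\<in>K V \<times> K V. card (D p)) \<le> card (K V \<times> K V) * m"
    using sum_bounded_above[of "K V \<times> K V" "\<lambda>p. card (D p)" m] finKK by (simp add: m_def)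
  also have "\<dots> = (card V choose n)\<^sup>2 * m"
    using V by (simp add: card_cartesian_product cardK power2_eq_square)
  finally show ?thesis
    using le AC that[of A C] by (simp add: K_def D_def)
qed

text \<open>Path counting makes linearly many vertices have linear degree in both relations;
  averaging over pairs of n-subsets then gives a common pair (A, C) for linearly many of them. Since
  n and q are fixed, that linear number eventually exceeds q.\<close>

lemma exists_biclique_pair:
  fixes n q :: nat
  assumes n: "n > 0"
  shows "\<exists>N0. \<forall>(V::'a set) P Q. finite V \<and> N0 \<le> card V \<and> P \<subseteq> V \<times> V \<and> Q \<subseteq> V \<times> V \<and>
    (\<forall>a\<in>V. \<forall>b\<in>V. a \<noteq> b \<longrightarrow> (a, b) \<in> P \<union> Q) \<and>
    (card V)\<^sup>2 \<le> 8 * card P \<and> (card V)\<^sup>2 \<le> 8 * card Q \<longrightarrow>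
    (\<exists>A B C. card A = n \<and> card C = n \<and> card B = q \<and> A \<times> B \<subseteq> P \<and> B \<times> C \<subseteq> Q)"
proof -
  \<comment> \<open>The factors 64 = 8 * 8 from the density hypotheses and 3 from path counting give
    192; with this choice 192 * \<epsilon> = 1/2.\<close>
  define \<epsilon> :: real where "\<epsilon> = 1 / 384"
  have eps: "\<epsilon> > 0" by (simp add: \<epsilon>_def)
  \<comment> \<open>This is what remains of \<epsilon> N (\<epsilon> N / n)^(2n) after division by
    N^(2n), up to the factor N: the guaranteed density of the set \<open>B\<close> below.\<close>
  define \<delta> where "\<delta> = \<epsilon> * (\<epsilon> / n) ^ (2 * n)"
  have delta: "\<delta> > 0" using n eps by (simp add: \<delta>_def)
  define N0 where "N0 = max 1 (max (nat \<lceil>q / \<delta>\<rceil>) (nat \<lceil>n / \<epsilon>\<rceil>))"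
  show ?thesis
  proof (intro exI[of _ N0] allI impI, elim conjE)
    fix V :: "'a set" and P Q
    assume V: "finite V" and N: "N0 \<le> card V" and P: "P \<subseteq> V \<times> V" and Q: "Q \<subseteq> V \<times> V"
      and total: "\<forall>a\<in>V. \<forall>b\<in>V. a \<noteq> b \<longrightarrow> (a, b) \<in> P \<union> Q"
      and cP: "(card V)\<^sup>2 \<le> 8 * card P" and cQ: "(card V)\<^sup>2 \<le> 8 * card Q"
    define N where "N = real (card V)"
    have N1: "N \<ge> 1" and Nq: "q \<le> \<delta> * N" and Nn: "n \<le> \<epsilon> * N"
      using N eps delta unfolding N_def N0_def
      by (auto simp: field_simps nat_le_iff ceiling_le_iff)
    define p where "p = (\<lambda>v. card (P\<inverse> `` {v}))"
    define r where "r = (\<lambda>v. card (Q `` {v}))"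
    have sub: "P\<inverse> `` {v} \<subseteq> V" "Q `` {v} \<subseteq> V" for v
      using P Q by auto
    have pN: "p v \<le> N" and rN: "r v \<le> N" for v
      unfolding p_def r_def N_def using card_mono[OF V sub(1)] card_mono[OF V sub(2)] by auto
    define M where "M = {v \<in> V. \<epsilon> * N \<le> p v \<and> \<epsilon> * N \<le> r v}"
    have finM: "finite M" using V by (simp add: M_def)
    have "N ^ 4 \<le> 64 * (real (card P) * real (card Q))"
    proof -
      have "N\<^sup>2 \<le> 8 * card P" "N\<^sup>2 \<le> 8 * card Q"
        using of_nat_mono[OF cP, where 'a = real] of_nat_mono[OF cQ, where 'a = real]
        by (simp_all add: N_def)
      then have "N\<^sup>2 * N\<^sup>2 \<le> (8 * real (card P)) * (8 * real (card Q))"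
        by (intro mult_mono) auto
      then show ?thesis by (simp flip: power_add)
    qed
    also have "real (card P) * real (card Q) \<le> 3 * N * (\<Sum>v\<in>V. real (p v) * real (r v))"
    proof -
      have "card P * card Q \<le> 3 * card V * (\<Sum>v\<in>V. p v * r v)"
        unfolding p_def r_def using card_mult_le_two_step_paths[OF V P Q] total by blast
      then have "real (card P * card Q) \<le> real (3 * card V * (\<Sum>v\<in>V. p v * r v))"
        by (rule of_nat_mono)
      then show ?thesis by (simp add: N_def)
    qed
    \<comment> \<open>Outside M one of the two degrees is below \<epsilon> N and the other is at
      most N; inside M both are bounded by N.\<close>
    also have "(\<Sum>v\<in>V. real (p v) * real (r v)) \<le> (\<Sum>v\<in>V. \<epsilon> * N * N + (if v \<in> M then N * N else 0))"
    proof (intro sum_mono)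
      fix v assume "v \<in> V"
      show "real (p v) * real (r v) \<le> \<epsilon> * N * N + (if v \<in> M then N * N else 0)"
      proof (cases "v \<in> M")
        case True
        have "real (p v) * real (r v) \<le> N * N"
          using pN rN N1 by (intro mult_mono) auto
        then show ?thesis using True eps N1 by (simp add: add_increasing)
      next
        case False
        then consider "real (p v) \<le> \<epsilon> * N" | "real (r v) \<le> \<epsilon> * N"
          using \<open>v \<in> V\<close> by (auto simp: M_def)
        then show ?thesis
        proof cases
          case 1
          then have "real (p v) * real (r v) \<le> (\<epsilon> * N) * N"
            using rN eps N1 by (intro mult_mono) auto
          then show ?thesis using False by simp
        next
          case 2
          then have "real (p v) * real (r v) \<le> N * (\<epsilon> * N)"
            using pN eps N1 by (intro mult_mono) auto
          then show ?thesis using False by (simp add: mult_ac)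
        qed
      qed
    qed
    also have "\<dots> = N * (\<epsilon> * N * N) + card M * (N * N)"
    proof -
      have "V \<inter> M = M" by (auto simp: M_def)
      then show ?thesis using V
        by (simp add: sum.distrib N_def flip: sum.inter_restrict)
    qed
    finally have "N ^ 4 \<le> 64 * (3 * N * (N * (\<epsilon> * N * N) + card M * (N * N)))"
      using N1 by simp
    then have "N ^ 3 * N \<le> N ^ 3 * (192 * (\<epsilon> * N + card M))"
      by (simp add: algebra_simps eval_nat_numeral)
    then have "N \<le> 192 * (\<epsilon> * N + card M)"
      using N1 by (subst (asm) mult_le_cancel_left_pos) auto
    \<comment> \<open>The vertices of low degree account for N/2, so 192 * \<open>card M\<close> is
      at least the other half.\<close>
    then have cM: "\<epsilon> * N \<le> card M"
      by (simp add: \<epsilon>_def)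
    then have Mne: "M \<noteq> {}"
      using eps N1 by (auto simp: mult_le_0_iff)
    \<comment> \<open>Degrees are integers, so the real threshold \<epsilon> N may be rounded up
      without losing a vertex of M.\<close>
    define k where "k = nat \<lceil>\<epsilon> * N\<rceil>"
    have k: "\<epsilon> * N \<le> k" unfolding k_def by linarith
    have nk: "n \<le> k" using k Nn by linarith
    have big: "k \<le> card (P\<inverse> `` {v})" "k \<le> card (Q `` {v})" if "v \<in> M" for v
      using that unfolding k_def M_def p_def r_def by (auto simp: nat_le_iff ceiling_le_iff)
    obtain A C where AC: "card A = n" "card C = n"
      and le: "card M * (k choose n)\<^sup>2 \<le> (card V choose n)\<^sup>2 * card {v \<in> M. A \<subseteq> P\<inverse> `` {v} \<and> C \<subseteq> Q `` {v}}"
      using exists_common_subset_pair[OF V finM Mne nk, of "\<lambda>v. P\<inverse> `` {v}" "\<lambda>v. Q `` {v}"]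
        sub big by blast
    define B where "B = {v \<in> M. A \<subseteq> P\<inverse> `` {v} \<and> C \<subseteq> Q `` {v}}"
    have "n \<le> card V" using Nn eps N1 by (simp add: \<epsilon>_def N_def)
    \<comment> \<open>The averaging bound is compared with powers of N on both sides, through
      (k/n)^n \<le> \<open>k choose n\<close> and \<open>card V choose n\<close> \<le> N^n;
      cancelling N^(2n) leaves \<delta> N \<le> \<open>card B\<close>.\<close>
    have "(\<epsilon> * N) * ((\<epsilon> * N / n) ^ n)\<^sup>2 \<le> card M * (real (k choose n))\<^sup>2"
    proof (intro mult_mono cM power_mono)
      have "(\<epsilon> * N / n) ^ n \<le> (real k / n) ^ n"
        using k eps N1 by (intro power_mono divide_right_mono) auto
      also have "\<dots> \<le> real (k choose n)"
        using binomial_ge_n_over_k_pow_k[OF nk, where 'a = real] by simp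
      finally show "(\<epsilon> * N / n) ^ n \<le> real (k choose n)" .
    qed (use eps N1 in auto)
    also have "\<dots> = real (card M * (k choose n)\<^sup>2)" by simp
    also have "\<dots> \<le> real ((card V choose n)\<^sup>2 * card B)"
      using le unfolding B_def by (rule of_nat_mono)
    also have "\<dots> = (real (card V choose n))\<^sup>2 * card B" by simp
    also have "\<dots> \<le> (N ^ n)\<^sup>2 * card B"
    proof (intro mult_right_mono power_mono)
      show "real (card V choose n) \<le> N ^ n"
        using binomial_le_pow[OF \<open>n \<le> card V\<close>] unfolding N_def by (metis of_nat_mono of_nat_power)
    qed auto
    finally have "(N ^ n)\<^sup>2 * (\<delta> * N) \<le> (N ^ n)\<^sup>2 * card B"
      unfolding \<delta>_def by (simp add: power_divide power_mult_distrib power_mult[symmetric] mult_ac)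
    then have "\<delta> * N \<le> card B"
      using N1 by (subst (asm) mult_le_cancel_left_pos) auto
    then have "q \<le> card B" using Nq by linarith
    then obtain B' where "B' \<subseteq> B" "card B' = q"
      by (meson obtain_subset_with_card_n)
    then have "A \<times> B' \<subseteq> P" "B' \<times> C \<subseteq> Q"
      by (auto simp: B_def)
    then show "\<exists>A B C. card A = n \<and> card C = n \<and> card B = q \<and> A \<times> B \<subseteq> P \<and> B \<times> C \<subseteq> Q"
      using AC \<open>card B' = q\<close> by blast
  qed
qed

section \<open>Embedding a regular bipartite graph\<close>

text \<open>No edge has two ends in X, so the stars at the vertices of S are pairwise disjoint, each
  with d edges. With S a whole side this counts all edges; with S half a side it measures the red
  part of the copy.\<close>

lemma card_edges_meeting:
  assumes "simple_graph G" "regular d G"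
    and XY: "X \<union> Y = verts G" "X \<inter> Y = {}" "\<forall>e\<in>edges G. \<exists>x\<in>X. \<exists>y\<in>Y. e = {x, y}"
    and S: "S \<subseteq> X"
  shows "card {e \<in> edges G. e \<inter> S \<noteq> {}} = d * card S"
proof -
  have fin: "finite (verts G)" "edges G \<subseteq> Pow (verts G)"
    using assms(1) by (auto simp: simple_graph_def)
  have finE: "finite (edges G)" using fin by (metis finite_Pow_iff finite_subset)
  have finS: "finite S" using S XY(1) fin(1) by (metis finite_Un finite_subset)
  have "{e \<in> edges G. e \<inter> S \<noteq> {}} = (\<Union>v\<in>S. {e \<in> edges G. v \<in> e})"
    by auto
  also have "card \<dots> = (\<Sum>v\<in>S. card {e \<in> edges G. v \<in> e})"
  proof (intro card_UN_disjoint ballI impI)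
    fix u v assume uv: "u \<in> S" "v \<in> S" "u \<noteq> v"
    have "\<not> (u \<in> e \<and> v \<in> e)" if e: "e \<in> edges G" for e
    proof -
      obtain x y where "e = {x, y}" "x \<in> X" "y \<in> Y" using XY(3) e by blast
      then show ?thesis using uv S XY(2) by blast
    qed
    then show "{e \<in> edges G. u \<in> e} \<inter> {e \<in> edges G. v \<in> e} = {}" by blast
  qed (use finS finE in auto)
  also have "\<dots> = (\<Sum>v\<in>S. d)"
    using assms(2) S XY(1) by (intro sum.cong) (auto simp: regular_def degree_def)
  finally show ?thesis by simp
qed

text \<open>One half S of X is sent to A, the other half to C, and Y to B. Every edge of G then
  lands between A and B or between B and C, where its colour is known, and it is red exactly when it
  meets S.\<close>

lemma balanced_copy_from_bicliques:
  fixes G :: "'a ugraph"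
  assumes d: "d > 0" and G: "simple_graph G" and reg: "regular d G" and bip: "bipartite G"
    and card: "card (verts G) = 4 * n"
    and sizes: "card A = n" "card C = n" "card B = 2 * n"
    and sub: "A \<subseteq> {..<N}" "B \<subseteq> {..<N}" "C \<subseteq> {..<N}"
    and disj: "A \<inter> B = {}" "A \<inter> C = {}" "B \<inter> C = {}"
    and red: "\<And>a b. a \<in> A \<Longrightarrow> b \<in> B \<Longrightarrow> \<alpha> {a, b} = Red"
    and blue: "\<And>b c. b \<in> B \<Longrightarrow> c \<in> C \<Longrightarrow> \<alpha> {b, c} = Blue"
  shows "contains_balanced_copy N \<alpha> G"
proof -
  obtain X Y where XY: "X \<union> Y = verts G" "X \<inter> Y = {}" "\<forall>e\<in>edges G. \<exists>x\<in>X. \<exists>y\<in>Y. e = {x, y}"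
    using bip by (auto simp: bipartite_def)
  have YX: "Y \<union> X = verts G" "Y \<inter> X = {}" "\<forall>e\<in>edges G. \<exists>y\<in>Y. \<exists>x\<in>X. e = {y, x}"
    using XY(1,2) by (simp_all add: Un_commute Int_commute) (use XY(3) in \<open>metis insert_commute\<close>)
  have finV: "finite (verts G)" and E: "\<And>e. e \<in> edges G \<Longrightarrow> e \<subseteq> verts G \<and> card e = 2"
    using G by (auto simp: simple_graph_def)
  have finE: "finite (edges G)"
    using E finV by (metis Pow_iff finite_Pow_iff finite_subset subsetI)
  have finXY: "finite X" "finite Y" using finV XY(1) by (metis finite_Un)+
  \<comment> \<open>Counting the edges from either side gives d |X| = d |Y|, and d > 0 makes both
    sides have size 2n.\<close>
  have "{e \<in> edges G. e \<inter> X \<noteq> {}} = edges G" "{e \<in> edges G. e \<inter> Y \<noteq> {}} = edges G"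
    using XY(3) by blast+
  then have cE: "card (edges G) = d * card X" "card (edges G) = d * card Y"
    using card_edges_meeting[OF G reg XY, of X] card_edges_meeting[OF G reg YX, of Y] by auto
  moreover have "card X + card Y = 4 * n"
    using card XY(1,2) finXY by (metis card_Un_disjoint)
  ultimately have cX: "card X = 2 * n" and cY: "card Y = 2 * n"
    using d by auto
  obtain S where S: "S \<subseteq> X" "card S = n"
    using cX by (metis obtain_subset_with_card_n le_add1 mult_2)
  have finS: "finite S" using S(1) finXY(1) by (rule finite_subset)
  have cXS: "card (X - S) = n" using S cX finS by (simp add: card_Diff_subset)
  have finABC: "finite A" "finite B" "finite C"
    using sub by (auto intro: finite_subset)
  obtain f1 f2 f3 where f1: "bij_betw f1 S A" and f2: "bij_betw f2 (X - S) C" and f3: "bij_betw f3 Y B"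
    using finite_same_card_bij[of S A] finite_same_card_bij[of "X - S" C] finite_same_card_bij[of Y B]
      finS finXY finABC S(2) cXS cY sizes by auto
  define f where "f = (\<lambda>v. if v \<in> S then f1 v else if v \<in> X then f2 v else f3 v)"
  have b1: "bij_betw f S A"
    using f1 by (rule bij_betw_cong[THEN iffD1, rotated]) (simp add: f_def)
  have b2: "bij_betw f (X - S) C"
    using f2 by (rule bij_betw_cong[THEN iffD1, rotated]) (simp add: f_def)
  have b3: "bij_betw f Y B"
    using f3 by (rule bij_betw_cong[THEN iffD1, rotated]) (use S(1) XY(2) in \<open>auto simp: f_def\<close>)
  have "bij_betw f (S \<union> (X - S) \<union> Y) (A \<union> C \<union> B)"
    using disj by (intro bij_betw_combine b1 b2 b3) auto
  moreover have "S \<union> (X - S) \<union> Y = verts G" using S XY(1) by auto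
  ultimately have bij: "bij_betw f (verts G) (A \<union> C \<union> B)" by simp
  then have inj: "inj_on f (verts G)" by (simp add: bij_betw_def)
  have fS: "f v \<in> A" if "v \<in> S" for v using b1 that by (auto simp: bij_betw_def)
  have fX: "f v \<in> C" if "v \<in> X - S" for v using b2 that unfolding bij_betw_def by blast
  have fY: "f v \<in> B" if "v \<in> Y" for v using b3 that by (auto simp: bij_betw_def)
  have fN: "f v < N" if "v \<in> verts G" for v
    using bij that sub unfolding bij_betw_def by blast
  define F1 where "F1 = {e \<in> edges G. e \<inter> S \<noteq> {}}"
  define F2 where "F2 = edges G - F1"
  define H :: "nat ugraph" where "H = \<lparr>verts = f ` verts G, edges = (image f) ` edges G\<rparr>"
  have injI: "inj_on (image f) (edges G)"
    using inj E by (meson inj_on_image_Pow inj_on_subset Pow_iff subsetI)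
  have ceq: "card (f ` e) = 2" if "e \<in> edges G" for e
    using E[OF that] inj by (metis card_image inj_on_subset)
  have cF1: "card F1 = d * n"
    unfolding F1_def using card_edges_meeting[OF G reg XY S(1)] S(2) by simp
  \<comment> \<open>There are 2nd edges in all, so the complement of the nd edges at S has the same
    size and the copy is balanced with difference 0.\<close>
  have cF2: "card F2 = d * n"
    unfolding F2_def using cF1 cE(1) cX finE by (subst card_Diff_subset) (auto simp: F1_def)
  have sub12: "F1 \<subseteq> edges G" "F2 \<subseteq> edges G" by (auto simp: F1_def F2_def)
  have "subgraph H (complete_graph N)"
    unfolding subgraph_def simple_graph_def H_def complete_graph_def
    using finV ceq fN E by (auto simp: subset_iff)
  moreover have "isomorphic G H"
    unfolding isomorphic_def
  proof (intro exI[of _ f] conjI ballI)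
    show "bij_betw f (verts G) (verts H)"
      using inj by (simp add: H_def bij_betw_def)
    fix u v assume uv: "u \<in> verts G" "v \<in> verts G"
    \<comment> \<open>Edges are reflected because the injective f also separates subsets of the
      vertex set.\<close>
    have "{u, v} \<in> edges G" if "f ` {u, v} = f ` e" "e \<in> edges G" for e
      using that inj_on_image_eq_iff[OF inj, of "{u, v}" e] uv E by auto
    then show "{u, v} \<in> edges G \<longleftrightarrow> {f u, f v} \<in> edges H"
      unfolding H_def by (auto simp: image_iff) (metis image_empty image_insert)
  qed
  moreover have "edges H = image f ` F1 \<union> image f ` F2"
    by (auto simp: H_def F1_def F2_def)
  moreover have "image f ` F1 \<inter> image f ` F2 = {}"
    using inj_on_image_Int[OF injI sub12] by (auto simp: F2_def)
  moreover have "\<forall>e\<in>image f ` F1. \<alpha> e = Red"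
  proof clarify
    fix e assume e: "e \<in> F1"
    then have "e \<in> edges G" using sub12 by auto
    then obtain x y where xy: "e = {x, y}" "x \<in> X" "y \<in> Y" using XY(3) by meson
    then have "x \<in> S" using e S(1) XY(2) by (auto simp: F1_def)
    then show "\<alpha> (f ` e) = Red" using red[of "f x" "f y"] fS fY xy by simp
  qed
  moreover have "\<forall>e\<in>image f ` F2. \<alpha> e = Blue"
  proof clarify
    fix e assume e: "e \<in> F2"
    then have "e \<in> edges G" using sub12 by auto
    then obtain x y where xy: "e = {x, y}" "x \<in> X" "y \<in> Y" using XY(3) by meson
    then have "x \<notin> S" using e by (auto simp: F1_def F2_def)
    then show "\<alpha> (f ` e) = Blue" using blue[of "f y" "f x"] fX fY xy by (simp add: insert_commute)
  qed
  moreover have "card (image f ` F1) = card (image f ` F2)"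
    using cF1 cF2 injI sub12 by (metis card_image inj_on_subset)
  ultimately show ?thesis
    unfolding contains_balanced_copy_def by (intro exI[of _ H] exI[of _ "image f ` F1"] exI[of _ "image f ` F2"]) simp
qed

section \<open>From colour classes to bicliques\<close>

theorem proposition10:
  fixes G :: "'a ugraph" and d n :: nat
  assumes "d > 0" and "n > 0"
    and "simple_graph G"
    and "bipartite G"
    and "regular d G"
    and "card (verts G) = 4 * n"
  shows "balanceable G"
proof -
  obtain N1 where N1: "\<forall>(V::nat set) P Q. finite V \<and> N1 \<le> card V \<and> P \<subseteq> V \<times> V \<and> Q \<subseteq> V \<times> V \<and>
    (\<forall>a\<in>V. \<forall>b\<in>V. a \<noteq> b \<longrightarrow> (a, b) \<in> P \<union> Q) \<and>
    (card V)\<^sup>2 \<le> 8 * card P \<and> (card V)\<^sup>2 \<le> 8 * card Q \<longrightarrow>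
    (\<exists>A B C. card A = n \<and> card C = n \<and> card B = 2 * n \<and> A \<times> B \<subseteq> P \<and> B \<times> C \<subseteq> Q)"
    using exists_biclique_pair[OF \<open>n > 0\<close>, of "2 * n"] by (rule exE)
  have main: "contains_balanced_copy N \<alpha> G"
    if N: "N \<ge> max N1 4"
      and col: "\<And>c. (N choose 2) div 2 \<le> card (color_class N \<alpha> c)" for N \<alpha>
  proof -
    \<comment> \<open>Each colour becomes a symmetric, loopless relation of ordered pairs, the form
      in which the biclique lemma takes its input.\<close>
    define P where "P = (\<lambda>c. {(a, b). a < N \<and> b < N \<and> a \<noteq> b \<and> \<alpha> {a, b} = c})"
    have Psub: "P c \<subseteq> {..<N} \<times> {..<N}" for c by (auto simp: P_def)
    have cP: "N\<^sup>2 \<le> 8 * card (P c)" for c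
    proof -
      \<comment> \<open>Choosing one orientation per edge suffices: the constant 8 leaves room for
        ignoring the other one.\<close>
      have "color_class N \<alpha> c \<subseteq> (\<lambda>(a, b). {a, b}) ` P c"
      proof
        fix e assume e: "e \<in> color_class N \<alpha> c"
        then obtain a b where "e = {a, b}" "a \<noteq> b"
          by (auto simp: color_class_def complete_graph_def card_2_iff)
        then show "e \<in> (\<lambda>(a, b). {a, b}) ` P c"
          using e by (intro image_eqI[of _ _ "(a, b)"]) (auto simp: color_class_def complete_graph_def P_def)
      qed
      then have "card (color_class N \<alpha> c) \<le> card (P c)"
        using Psub by (meson finite_SigmaI finite_lessThan finite_subset surj_card_le)
      then have "N * (N - 1) div 2 div 2 \<le> card (P c)"
        using col[of c] by (simp add: choose_two)
      \<comment> \<open>The nested \<open>div\<close> loses at most 3/4 from N(N-1)/4, hence at most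
        6 after scaling by 8; for N \<ge> 4 the excess of 2N(N-1) over N^2 covers this.\<close>
      moreover have "N\<^sup>2 + 8 \<le> 2 * (N * (N - 1)) + 2"
      proof -
        obtain j where "N = j + 4" using N by (metis max.boundedE le_add_diff_inverse2)
        then show ?thesis by (simp add: power2_eq_square algebra_simps)
      qed
      moreover have "even (N * (N - 1))" by (cases N) simp_all
      ultimately show ?thesis by presburger
    qed
    have tot: "a \<noteq> b \<longrightarrow> (a, b) \<in> P Red \<union> P Blue" if "a \<in> {..<N}" "b \<in> {..<N}" for a b
      using that color.exhaust by (auto simp: P_def)
    obtain A B C where ABC: "card A = n" "card C = n" "card B = 2 * n"
      "A \<times> B \<subseteq> P Red" "B \<times> C \<subseteq> P Blue"
      using N1[rule_format, of "{..<N}" "P Red" "P Blue"] N Psub cP tot by auto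
    have ne: "A \<noteq> {}" "B \<noteq> {}" "C \<noteq> {}" using ABC \<open>n > 0\<close> by auto
    have AB: "a < N \<and> b < N \<and> a \<noteq> b \<and> \<alpha> {a, b} = Red" if "a \<in> A" "b \<in> B" for a b
      using that ABC(4) by (auto simp: P_def)
    have BC: "b < N \<and> c < N \<and> b \<noteq> c \<and> \<alpha> {b, c} = Blue" if "b \<in> B" "c \<in> C" for b c
      using that ABC(5) by (auto simp: P_def)
    \<comment> \<open>The biclique lemma does not promise disjoint sets. A vertex common to A and C
      would give its edge to a vertex of B both colours; the other two intersections are empty
      because the relations are loopless.\<close>
    have "A \<inter> C = {}"
    proof (rule ccontr)
      assume "A \<inter> C \<noteq> {}"
      then obtain x b where "x \<in> A" "x \<in> C" "b \<in> B" using ne by blast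
      then show False using AB[of x b] BC[of b x] by (simp add: insert_commute)
    qed
    moreover have "A \<inter> B = {}" "B \<inter> C = {}" using AB BC by blast+
    moreover have "A \<subseteq> {..<N}" "B \<subseteq> {..<N}" "C \<subseteq> {..<N}" using AB BC ne by blast+
    ultimately show ?thesis
      using assms ABC AB BC by (intro balanced_copy_from_bicliques[where d = d and n = n and A = A and B = B and C = C]) auto
  qed
  show ?thesis
    unfolding balanceable_def
  proof (rule exI[of _ "max N1 4"], intro allI impI)
    fix N assume N: "N \<ge> max N1 4"
    have "4 choose 2 \<le> N choose 2" using N by (intro binomial_right_mono) simp
    \<comment> \<open>The witness for m is \<open>(N choose 2) div 2 - 1\<close>, the largest value
      allowed. Positivity makes the truncated subtraction exact, so exceeding m means containing at
      least \<open>(N choose 2) div 2\<close> edges.\<close>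
    then have "(N choose 2) div 2 > 0" by (simp add: choose_two)
    moreover have "contains_balanced_copy N \<alpha> G"
      if "(N choose 2) div 2 - 1 < card (color_class N \<alpha> Red) \<and>
          (N choose 2) div 2 - 1 < card (color_class N \<alpha> Blue)" for \<alpha>
    proof (rule main[OF N])
      fix c
      show "(N choose 2) div 2 \<le> card (color_class N \<alpha> c)"
        using that by (cases c) auto
    qed
    ultimately show "\<exists>m<(N choose 2) div 2. \<forall>\<alpha>. m < card (color_class N \<alpha> Red) \<and> m < card (color_class N \<alpha> Blue) \<longrightarrow>
        contains_balanced_copy N \<alpha> G"
      by (intro exI[of _ "(N choose 2) div 2 - 1"]) simp
  qed
qed

end
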